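(* Let $n,p\ge 1$, let $X\in\mathbb{R}^{n\times p}$ satisfy $\mathrm{diag}(X^\top X)=nI_p$, let $\hat\Sigma=X^\top X/n$, and let $S\subseteq\{1,\dots,p\}$ be nonempty with $s=|S|$ and $S^c=\{1,\dots,p\}\setminus S$. Let $$\phi^2=\min\left\{s\,v^\top\hat\Sigma v\;:\; v\in\mathbb{R}^p,\ \|v_S\|_1=1,\ \|v_{S^c}\|_1\le 3\right\}.$$ Then for every sufficiently large constant $M>0$ (that is, there is $M_0>0$ such that for all $M\ge M_0$), $\phi^2$ equals $s$ times the optimal value of the mixed-integer quadratic program $$\begin{aligned}\min\quad & v^\top\hat\Sigma v\\ \text{subject to}\quad & v_j=v_j^+-v_j^-\quad (j\in S),\\ & \sum_{j\in S}(v_j^++v_j^-)=1,\\ & v_j^+\le M b_j,\quad v_j^-\le M(1-b_j)\quad(j\in S),\\ & -u_j\le v_j\le u_j\quad(j\in S^c),\\ & \sum_{j\in S^c}u_j\le 3,\end{aligned}$$ where the minimum is over $v_j^+,v_j^-\ge 0$ and $b_j\in\{0,1\}$ for $j\in S$, and $v_j\in\mathbb{R}$ and $u_j\ge 0$ for $j\in S^c$.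
   Context: For $v\in\mathbb{R}^p$ and $A\subseteq\{1,\dots,p\}$, $v_A$ denotes the subvector $(v_j)_{j\in A}$ and $\|v_A\|_1=\sum_{j\in A}|v_j|$. The quantity $\phi\ge 0$ is called the compatibility constant of the design matrix $X$ with respect to the support $S$. *)

theory Defs
  imports "HOL-Analysis.Analysis"
begin

definition is_minimum :: "'a::order set \<Rightarrow> 'a \<Rightarrow> bool" where
  "is_minimum A m \<longleftrightarrow> m \<in> A \<and> (\<forall>x\<in>A. m \<le> x)"

definition l1_on :: "'p set \<Rightarrow> real ^ 'p::finite \<Rightarrow> real" where
  "l1_on A v = (\<Sum>j\<in>A. \<bar>v $ j\<bar>)"

text \<open>The design matrix \<open>X\<close> has rows indexed by \<open>'n\<close> and columns indexed by \<open>'p\<close>,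
  so the sample size is \<open>CARD('n)\<close>.\<close>

definition Sigma_hat :: "real ^ 'p::finite ^ 'n::finite \<Rightarrow> real ^ 'p ^ 'p" where
  "Sigma_hat X = (1 / real CARD('n)) *\<^sub>R (transpose X ** X)"

definition quad :: "real ^ 'p::finite ^ 'n::finite \<Rightarrow> real ^ 'p \<Rightarrow> real" where
  "quad X v = v \<bullet> (Sigma_hat X *v v)"

definition compat_values :: "real ^ 'p::finite ^ 'n::finite \<Rightarrow> 'p set \<Rightarrow> real set" where
  "compat_values X S =
     {real (card S) * quad X v | v. l1_on S v = 1 \<and> l1_on (- S) v \<le> 3}"

definition compat_const :: "real ^ 'p::finite ^ 'n::finite \<Rightarrow> 'p set \<Rightarrow> real" where
  "compat_const X S = sqrt (LEAST c. c \<in> compat_values X S)"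

text \<open>All variables of the program are indexed by the whole of \<open>'p\<close>. The components of
  \<open>vp\<close>, \<open>vm\<close>, \<open>b\<close> outside \<open>S\<close> and those of \<open>u\<close> inside \<open>S\<close> are unconstrained dummies which
  do not enter the objective. The components of \<open>v\<close> in \<open>S\<close> are determined by \<open>vp\<close> and \<open>vm\<close>.\<close>

definition miqp_feasible ::
  "'p::finite set \<Rightarrow> real \<Rightarrow> real ^ 'p \<Rightarrow> real ^ 'p \<Rightarrow> real ^ 'p \<Rightarrow> real ^ 'p \<Rightarrow> real ^ 'p \<Rightarrow> bool"
  where
  "miqp_feasible S M v vp vm b u \<longleftrightarrow>
     (\<forall>j\<in>S. vp $ j \<ge> 0 \<and> vm $ j \<ge> 0 \<and> b $ j \<in> {0, 1}) \<and>
     (\<forall>j\<in>- S. u $ j \<ge> 0) \<and>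
     (\<forall>j\<in>S. v $ j = vp $ j - vm $ j) \<and>
     (\<Sum>j\<in>S. vp $ j + vm $ j) = 1 \<and>
     (\<forall>j\<in>S. vp $ j \<le> M * b $ j \<and> vm $ j \<le> M * (1 - b $ j)) \<and>
     (\<forall>j\<in>- S. - u $ j \<le> v $ j \<and> v $ j \<le> u $ j) \<and>
     (\<Sum>j\<in>- S. u $ j) \<le> 3"

definition miqp_values ::
  "real ^ 'p::finite ^ 'n::finite \<Rightarrow> 'p set \<Rightarrow> real \<Rightarrow> real set" where
  "miqp_values X S M = {quad X v | v vp vm b u. miqp_feasible S M v vp vm b u}"

end

(* For M \<ge> 1 the binary b j selects the sign of v j: it forces one of vp j, vm j to vanish,
   so that vp j + vm j = |v j|, while conversely |v j| \<le> 1 makes the big-M bounds harmless.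
   Hence the program minimizes over the same compact set of vectors v as the
   compatibility constant, and the minimum is attained. *)
theory Submission
  imports Defs
begin

definition compat_region :: "'p set \<Rightarrow> (real ^ 'p::finite) set" where
  "compat_region S = {v. l1_on S v = 1 \<and> l1_on (- S) v \<le> 3}"

lemma continuous_on_l1_on: "continuous_on UNIV (l1_on A)"
  unfolding l1_on_def by (intro continuous_intros)

text \<open>Moving \<open>transpose X\<close> across the inner product turns the form into a scaled
  squared norm, from which both nonnegativity and continuity can be read off.\<close>

lemma quad_eq: "quad X v = (norm (X *v v))\<^sup>2 / real CARD('n)"
  for X :: "real ^ 'p::finite ^ 'n::finite"
proof -
  have "v \<bullet> ((transpose X ** X) *v v) = (norm (X *v v))\<^sup>2"
    by (simp add: matrix_vector_mul_assoc [symmetric] dot_lmul_matrix [symmetric]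
        vector_transpose_matrix power2_norm_eq_inner)
       (metis dot_lmul_matrix inner_commute transpose_matrix_vector)
  then show ?thesis
    by (simp add: quad_def Sigma_hat_def scaleR_matrix_vector_assoc [symmetric])
qed

lemma quad_nonneg: "0 \<le> quad X v"
  by (simp add: quad_eq)

lemma continuous_on_quad: "continuous_on A (quad X)"
  unfolding quad_eq by (intro continuous_intros) auto

lemma compact_compat_region: "compact (compat_region S)"
proof -
  \<comment> \<open>The bound is 1 + 3: the full l1 norm splits over \<open>S\<close> and
    \<open>- S\<close>, and it dominates the Euclidean norm.\<close>
  have "norm v \<le> 4" if "v \<in> compat_region S" for v
  proof -
    have "norm v \<le> (\<Sum>j\<in>UNIV. \<bar>v $ j\<bar>)"
      by (rule norm_le_l1_cart)
    also have "\<dots> = l1_on S v + l1_on (- S) v"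
      unfolding l1_on_def by (subst sum.union_disjoint [symmetric]) auto
    also have "\<dots> \<le> 4"
      using that by (simp add: compat_region_def)
    finally show ?thesis .
  qed
  then have "bounded (compat_region S)"
    unfolding bounded_iff by blast
  moreover have "closed (compat_region S)"
    unfolding compat_region_def
    by (intro closed_Collect_conj closed_Collect_eq closed_Collect_le continuous_on_l1_on
        continuous_on_const)
  ultimately show ?thesis
    by (simp add: compact_eq_bounded_closed)
qed

lemma compat_region_nonempty:
  assumes "S \<noteq> {}"
  shows "compat_region S \<noteq> {}"
proof -
  obtain i where "i \<in> S"
    using assms by blast
  \<comment> \<open>A unit vector at an index of \<open>S\<close> has all its l1 mass in
    \<open>S\<close>.\<close>
  then have "axis i 1 \<in> compat_region S"
    by (auto simp: compat_region_def l1_on_def axis_def if_distrib [of abs] cong: if_cong)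
  then show ?thesis
    by blast
qed

lemma miqp_feasible_imp_compat_region:
  assumes "miqp_feasible S M v vp vm b u"
  shows "v \<in> compat_region S"
proof -
  have "\<bar>v $ j\<bar> = vp $ j + vm $ j" if "j \<in> S" for j
  proof -
    have "b $ j = 0 \<or> b $ j = 1"
      using assms that by (auto simp: miqp_feasible_def)
    \<comment> \<open>One of the two upper bounds is \<open>M * 0\<close>, which together with
      nonnegativity forces that part to vanish; the size of \<open>M\<close> matters only for the
      converse lemma.\<close>
    then have "vp $ j = 0 \<or> vm $ j = 0"
      using assms that by (fastforce simp: miqp_feasible_def)
    then show ?thesis
      using assms that by (auto simp: miqp_feasible_def)
  qed
  then have "l1_on S v = 1"
    using assms by (simp add: l1_on_def miqp_feasible_def)
  moreover have "l1_on (- S) v \<le> (\<Sum>j\<in>- S. u $ j)"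
    unfolding l1_on_def using assms
    by (intro sum_mono) (simp add: miqp_feasible_def abs_le_iff minus_le_iff)
  ultimately show ?thesis
    using assms by (auto simp: compat_region_def miqp_feasible_def)
qed

text \<open>The witnesses are the positive and negative parts of \<open>v\<close>, the indicator of
  a nonnegative entry, and the absolute values. The threshold 1 for \<open>M\<close> suffices
  because no entry in \<open>S\<close> can exceed the total l1 mass 1 on \<open>S\<close>.\<close>

lemma compat_region_imp_miqp_feasible:
  assumes "v \<in> compat_region S" "1 \<le> M"
  shows "miqp_feasible S M v (\<chi> j. max (v $ j) 0) (\<chi> j. max (- v $ j) 0)
    (\<chi> j. if 0 \<le> v $ j then 1 else 0) (\<chi> j. \<bar>v $ j\<bar>)"
proof -
  have sum1: "(\<Sum>j\<in>S. \<bar>v $ j\<bar>) = 1" and sum2: "(\<Sum>j\<in>- S. \<bar>v $ j\<bar>) \<le> 3"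
    using assms(1) by (auto simp: compat_region_def l1_on_def)
  have "\<bar>v $ j\<bar> \<le> M" if "j \<in> S" for j
    using member_le_sum [of j S "\<lambda>j. \<bar>v $ j\<bar>"] that sum1 assms(2) by simp
  then have le: "v $ j \<le> M" "- v $ j \<le> M" if "j \<in> S" for j
    using that by (force simp: abs_le_iff)+
  have "max (v $ j) 0 + max (- v $ j) 0 = \<bar>v $ j\<bar>" for j
    by auto
  with sum1 have "(\<Sum>j\<in>S. max (v $ j) 0 + max (- v $ j) 0) = 1"
    by simp
  then show ?thesis
    using sum2 le assms(2) by (auto simp: miqp_feasible_def)
qed

lemma miqp_values_eq:
  assumes "1 \<le> M"
  shows "miqp_values X S M = quad X ` compat_region S"
  using miqp_feasible_imp_compat_region compat_region_imp_miqp_feasible [OF _ assms]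
  unfolding miqp_values_def by fast

theorem mainTheorem2:
  fixes X :: "real ^ 'p::finite ^ 'n::finite" and S :: "'p set"
  assumes "\<forall>j. (transpose X ** X) $ j $ j = real CARD('n)"
    and "S \<noteq> {}"
  shows "is_minimum (compat_values X S) ((compat_const X S)\<^sup>2) \<and>
    (\<exists>M0>0. \<forall>M\<ge>M0. \<exists>q. is_minimum (miqp_values X S M) q \<and>
       (compat_const X S)\<^sup>2 = real (card S) * q)"
proof -
  obtain w where w: "w \<in> compat_region S" "\<forall>v\<in>compat_region S. quad X w \<le> quad X v"
    using continuous_attains_inf [OF compact_compat_region compat_region_nonempty [OF assms(2)]
        continuous_on_quad] by blast
  have min: "is_minimum (compat_values X S) (real (card S) * quad X w)"
    using w by (auto simp: is_minimum_def compat_values_def compat_region_def mult_left_mono)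
  \<comment> \<open>\<open>LEAST\<close> over the reals is determined here because the minimum is
    attained, at \<open>w\<close>.\<close>
  then have "(LEAST c. c \<in> compat_values X S) = real (card S) * quad X w"
    by (auto simp: is_minimum_def intro: Least_equality)
  \<comment> \<open>Squaring undoes the \<open>sqrt\<close> because the minimum is
    nonnegative.\<close>
  then have const: "(compat_const X S)\<^sup>2 = real (card S) * quad X w"
    by (simp add: compat_const_def quad_nonneg)
  \<comment> \<open>The same \<open>w\<close> is optimal for every such \<open>M\<close>, so
    \<open>M0 = 1\<close> works.\<close>
  have "is_minimum (miqp_values X S M) (quad X w)" if "1 \<le> M" for M
    using w by (simp add: is_minimum_def miqp_values_eq [OF that])
  then show ?thesis
    using min const by (metis zero_less_one)
qed

end
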